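(* For every integer $n > 9$ with $n \equiv 1 \pmod 4$, $DD_{\mathrm{m}}(P_3 \,\square\, P_n)=\gamma(P_3 \,\square\, P_n)+1$.
   Context: $P_k$ is the path on $k$ vertices and $\gamma(G)$ is the domination number of $G$. $G\,\square\,H$ denotes the Cartesian product: vertex set $V(G)\times V(H)$, with $(a,b)$ and $(c,d)$ adjacent iff $a=c$ and $bd\in E(H)$, or $ac\in E(G)$ and $b=d$. Swap number: a dominating set $D$ of a graph $G$ is a swap set if there is a dominating set $D'$ of $G$ with $D\cap D'=\emptyset$, $|D|=|D'|$, such that $G$ contains a perfect matching between $D$ and $D'$ (a bijection $f:D\to D'$ with $x f(x)\in E(G)$ for all $x\in D$). $DD_{\mathrm{m}}(G)$ is the minimum cardinality of a swap set of $G$, and $DD_{\mathrm{m}}(G)=\infty$ if none exists. *)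

theory Defs
  imports "Graph_Theory.Pair_Digraph" "HOL-Library.Extended_Nat"
begin

text \<open>
  Finite simple graphs are the instances of the locale \<^locale>\<open>pair_graph\<close>: an undirected edge
  \<open>uv\<close> is represented by the two arcs \<open>(u, v)\<close> and \<open>(v, u)\<close>. The definitions below are meant for
  such graphs, where all vertex sets involved are finite and \<^const>\<open>card\<close> is the true cardinality.
\<close>

definition path_graph :: "nat \<Rightarrow> nat pair_pre_digraph" where
  "path_graph k =
     \<lparr> pverts = {1..k},
       parcs = {(i, j). i \<in> {1..k} \<and> j \<in> {1..k} \<and> (j = i + 1 \<or> i = j + 1)} \<rparr>"

definition cartesian_product ::
  "'a pair_pre_digraph \<Rightarrow> 'b pair_pre_digraph \<Rightarrow> ('a \<times> 'b) pair_pre_digraph"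
  (infixr \<open>\<box>\<close> 80) where
  "G \<box> H =
     \<lparr> pverts = pverts G \<times> pverts H,
       parcs = {((a, b), (c, d)).
         (a \<in> pverts G \<and> a = c \<and> (b, d) \<in> parcs H) \<or>
         ((a, c) \<in> parcs G \<and> b \<in> pverts H \<and> b = d)} \<rparr>"

lemma pair_graph_path_graph: "pair_graph (path_graph k)"
proof
  show "finite (parcs (path_graph k))"
    by (rule finite_subset[of _ "{1..k} \<times> {1..k}"]) (auto simp: path_graph_def)
  show "symmetric (with_proj (path_graph k))"
    by (auto simp: symmetric_def sym_def path_graph_def)
qed (auto simp: path_graph_def)

lemma pair_graph_cartesian_product:
  assumes "pair_graph G" and "pair_graph H"
  shows "pair_graph (G \<box> H)"
proof -
  interpret G: pair_graph G by fact
  interpret H: pair_graph H by fact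
  have wf: "parcs (G \<box> H) \<subseteq> pverts (G \<box> H) \<times> pverts (G \<box> H)"
    by (auto simp: cartesian_product_def dest: G.wellformed' H.wellformed')
  have fin: "finite (pverts (G \<box> H))"
    by (simp add: cartesian_product_def)
  show ?thesis
  proof
    show "finite (parcs (G \<box> H))"
      using wf fin by (meson finite_SigmaI finite_subset)
    show "symmetric (with_proj (G \<box> H))"
      using G.sym_arcs H.sym_arcs
      by (auto simp: symmetric_def sym_def cartesian_product_def)
    show "fst e \<noteq> snd e" if "e \<in> parcs (G \<box> H)" for e
      using that G.no_loops H.no_loops by (fastforce simp: cartesian_product_def)
  qed (use wf fin in auto)
qed

definition dominating_set :: "'a pair_pre_digraph \<Rightarrow> 'a set \<Rightarrow> bool" where
  "dominating_set G D \<longleftrightarrow>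
     D \<subseteq> pverts G \<and> (\<forall>v \<in> pverts G - D. \<exists>u \<in> D. (u, v) \<in> parcs G)"

definition domination_number :: "'a pair_pre_digraph \<Rightarrow> nat" where
  "domination_number G = (LEAST k. \<exists>D. dominating_set G D \<and> card D = k)"

definition swap_set :: "'a pair_pre_digraph \<Rightarrow> 'a set \<Rightarrow> bool" where
  "swap_set G D \<longleftrightarrow>
     dominating_set G D \<and>
     (\<exists>D'. dominating_set G D' \<and> D \<inter> D' = {} \<and> card D = card D' \<and>
       (\<exists>f. bij_betw f D D' \<and> (\<forall>x \<in> D. (x, f x) \<in> parcs G)))"

text \<open>In \<^typ>\<open>enat\<close> the infimum of a nonempty set is its minimum, and that of the empty set is \<open>\<infinity>\<close>.\<close>

definition swap_number :: "'a pair_pre_digraph \<Rightarrow> enat" where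
  "swap_number G = Inf {enat (card D) | D. swap_set G D}"

end

theory Submission
  imports Defs
begin

text \<open>
  If one of the \<open>n\<close> columns of an \<open>m\<close>-row grid contains no cell of a dominating set, then the two
  adjacent columns contain at least \<open>m\<close> of its cells. For \<open>m \<le> 4\<close>, let every nonempty column with
  \<open>c\<close> cells pass half of its surplus \<open>4 * c - m \<ge> 0\<close> to each of its empty neighbours. This makes up
  for the deficit \<open>m\<close> of every empty column, and something is left over at both ends of the grid.
  For \<open>m = 3\<close> and \<open>n = 4 * k + 1\<close> it follows that a dominating set has at least \<open>3 * k + 1\<close> cells,
  and that equality forces the last column to consist of the middle cell alone. Hence no two
  minimum dominating sets are disjoint, whereas a single additional cell allows for a swap set.
\<close>

section \<open>Minimum dominating sets and swap sets\<close>

lemma domination_number_le: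
  "dominating_set G D \<Longrightarrow> domination_number G \<le> card D"
  unfolding domination_number_def by (rule Least_le) blast

lemma domination_number_eqI:
  assumes "dominating_set G D" and "card D \<le> k"
    and "\<And>E. dominating_set G E \<Longrightarrow> k \<le> card E"
  shows "domination_number G = k"
  unfolding domination_number_def by (rule Least_equality) (use assms in \<open>auto intro: le_antisym\<close>)

lemma swap_setI:
  assumes "dominating_set G D" and "dominating_set G D'" and "D \<inter> D' = {}"
    and "bij_betw f D D'" and "\<And>x. x \<in> D \<Longrightarrow> (x, f x) \<in> parcs G"
  shows "swap_set G D"
  unfolding swap_set_def using assms bij_betw_same_card by blast

lemma swap_number_eq_Suc_domination_number:
  assumes common: "\<And>D. dominating_set G D \<Longrightarrow> card D = domination_number G \<Longrightarrow> v \<in> D"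
    and swap: "swap_set G D" "card D \<le> domination_number G + 1"
  shows "swap_number G = enat (domination_number G + 1)"
  unfolding swap_number_def
proof (rule antisym)
  show "Inf {enat (card D) |D. swap_set G D} \<le> enat (domination_number G + 1)"
    by (rule Inf_lower2[of "enat (card D)"]) (use swap in auto)
  have "domination_number G + 1 \<le> card E" if E: "swap_set G E" for E
  proof -
    obtain E' where "dominating_set G E" "dominating_set G E'" "E \<inter> E' = {}" "card E = card E'"
      using E unfolding swap_set_def by blast
    then have "domination_number G \<le> card E" and "card E \<noteq> domination_number G"
      using common domination_number_le by (fastforce, metis disjoint_iff)
    then show ?thesis by simp
  qed
  then show "enat (domination_number G + 1) \<le> Inf {enat (card D) |D. swap_set G D}"
    by (intro Inf_greatest) auto
qed

section \<open>Dominating sets of grids\<close>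

abbreviation (input) grid :: "nat \<Rightarrow> nat \<Rightarrow> (nat \<times> nat) pair_pre_digraph" where
  "grid m n \<equiv> path_graph m \<box> path_graph n"

lemma pverts_grid: "pverts (grid m n) = {1..m} \<times> {1..n}"
  by (simp add: cartesian_product_def path_graph_def)

lemma parcs_grid_iff:
  "((r, i), (s, j)) \<in> parcs (grid m n) \<longleftrightarrow>
     r \<in> {1..m} \<and> s \<in> {1..m} \<and> i \<in> {1..n} \<and> j \<in> {1..n} \<and>
     (r = s \<and> (j = Suc i \<or> i = Suc j) \<or> i = j \<and> (s = Suc r \<or> r = Suc s))"
  by (auto simp: cartesian_product_def path_graph_def)

lemma grid_neighbour_iff:
  assumes "D \<subseteq> {1..m} \<times> {1..n}" and "r \<in> {1..m}" and "i \<in> {1..n}"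
  shows "(\<exists>u \<in> D. (u, (r, i)) \<in> parcs (grid m n)) \<longleftrightarrow>
     (r - 1, i) \<in> D \<or> (Suc r, i) \<in> D \<or> (r, i - 1) \<in> D \<or> (r, Suc i) \<in> D"
    (is "?L \<longleftrightarrow> ?R")
proof
  show ?L if ?R
    using that assms by (elim disjE) (force simp: parcs_grid_iff)+
qed (auto simp: parcs_grid_iff)

text \<open>The indices \<open>0\<close> and \<open>Suc m\<close> or \<open>Suc n\<close> lie outside the grid, so no border cases arise.\<close>

lemma dominating_set_grid_iff:
  "dominating_set (grid m n) D \<longleftrightarrow>
     D \<subseteq> {1..m} \<times> {1..n} \<and>
     (\<forall>r \<in> {1..m}. \<forall>i \<in> {1..n}.
        (r, i) \<in> D \<or> (r - 1, i) \<in> D \<or> (Suc r, i) \<in> D \<or> (r, i - 1) \<in> D \<or> (r, Suc i) \<in> D)"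
proof (cases "D \<subseteq> {1..m} \<times> {1..n}")
  case True
  then show ?thesis
    unfolding dominating_set_def pverts_grid
    using grid_neighbour_iff[OF True] by (simp add: Ball_def) blast
qed (simp add: dominating_set_def pverts_grid)

lemma dominating_set_grid_subset: "dominating_set (grid m n) D \<Longrightarrow> D \<subseteq> {1..m} \<times> {1..n}"
  by (simp add: dominating_set_def pverts_grid)

definition column :: "('a \<times> 'b) set \<Rightarrow> 'b \<Rightarrow> 'a set" where
  "column D i = {r. (r, i) \<in> D}"

lemma finite_column: "D \<subseteq> A \<times> B \<Longrightarrow> finite A \<Longrightarrow> finite (column D i)"
  by (rule finite_subset[of _ A]) (auto simp: column_def)

lemma column_eq_empty: "D \<subseteq> A \<times> B \<Longrightarrow> i \<notin> B \<Longrightarrow> column D i = {}"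
  by (auto simp: column_def)

lemma card_eq_sum_card_column:
  assumes "D \<subseteq> A \<times> B" and "finite A" and "finite B"
  shows "card D = (\<Sum>i \<in> B. card (column D i))"
proof -
  have "card D = card (prod.swap ` D)"
    by (simp add: card_image)
  also have "prod.swap ` D = (SIGMA i:B. column D i)"
    using assms(1) by (force simp: column_def)
  also have "card \<dots> = (\<Sum>i \<in> B. card (column D i))"
    using assms finite_column by (intro card_SigmaI) auto
  finally show ?thesis .
qed

lemma card_columns_adjacent_to_empty:
  assumes D: "dominating_set (grid m n) D"
    and "i < n" and "card (column D (Suc i)) = 0"
  shows "m \<le> card (column D i) + card (column D (Suc (Suc i)))"
proof -
  have fin: "finite (column D j)" for j
    by (rule finite_column[OF dominating_set_grid_subset[OF D]]) simp
  then have "column D (Suc i) = {}" using assms(3) by simp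
  moreover have "Suc i \<in> {1..n}" using \<open>i < n\<close> by simp
  ultimately have "{1..m} \<subseteq> column D i \<union> column D (Suc (Suc i))"
    using D by (fastforce simp: dominating_set_grid_iff column_def)
  then have "card {1..m} \<le> card (column D i \<union> column D (Suc (Suc i)))"
    using fin by (intro card_mono) auto
  also have "\<dots> \<le> card (column D i) + card (column D (Suc (Suc i)))"
    by (rule card_Un_le)
  finally show ?thesis by simp
qed

section \<open>The discharging argument\<close>

context
  fixes c :: "nat \<Rightarrow> nat" and m n :: nat
  assumes c_0: "c 0 = 0"
    and gap: "\<And>i. i < n \<Longrightarrow> c (Suc i) = 0 \<Longrightarrow> m \<le> c i + c (Suc (Suc i))"
begin

text \<open>
  The total surplus \<open>4 * c j - m\<close> of the first \<open>Suc i\<close> columns is at least \<open>(4 - m) / 2\<close>, left over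
  at the left end, plus the half that the last column can still pass to the right. If the last
  column is empty, then of its deficit \<open>m\<close> only the share coming from the left has been paid.
\<close>

lemma partial_sum_gap_ge:
  assumes "2 \<le> m" and "m \<le> 4" and "i < n"
  shows "m * i + 2 + (if c (Suc i) = 0 then 2 * c i else m + 2 * c (Suc i))
           \<le> 4 * (\<Sum>j = 1..Suc i. c j) + m"
  using \<open>i < n\<close>
proof (induction i)
  case 0
  then show ?case using c_0 assms by simp
next
  case (Suc i)
  then show ?case using gap[of i] assms by (auto split: if_splits)
qed

lemma sum_gap_ge:
  assumes "2 \<le> m" and "m \<le> 4" and "0 < n" and "c (Suc n) = 0"
  shows "m * n + 4 \<le> 4 * (\<Sum>j = 1..n. c j) + m"
proof -
  obtain p where n: "n = Suc p"
    using \<open>0 < n\<close> gr0_implies_Suc by blast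
  show ?thesis
    using partial_sum_gap_ge[of p] gap[of p] assms unfolding n by (auto split: if_splits)
qed

lemma tight_sum_gap_last:
  assumes "3 \<le> m" and "m \<le> 4" and "0 < n" and "c (Suc n) = 0"
    and "4 * (\<Sum>j = 1..n. c j) + m = m * n + 4"
  shows "c n = 1"
proof -
  obtain p where n: "n = Suc p"
    using \<open>0 < n\<close> gr0_implies_Suc by blast
  show ?thesis
    using partial_sum_gap_ge[of p] gap[of p] assms unfolding n by (auto split: if_splits)
qed

lemma tight_sum_gap_penultimate:
  assumes "2 \<le> m" and "m \<le> 3" and "c n = 1"
    and "4 * (\<Sum>j = 1..n. c j) + m = m * n + 4"
  shows "c (n - 1) = 0"
proof -
  consider (le_1) "n \<le> 1" | (Suc_Suc) q where "n = Suc (Suc q)"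
    by (metis One_nat_def Suc_le_mono le0 not0_implies_Suc)
  then show ?thesis
  proof cases
    case le_1
    then show ?thesis using c_0 by simp
  next
    case Suc_Suc
    then show ?thesis
      using partial_sum_gap_ge[of q] assms by (auto split: if_splits)
  qed
qed

end

lemma card_dominating_set_grid_ge:
  assumes D: "dominating_set (grid m n) D" and "2 \<le> m" and "m \<le> 4" and "0 < n"
  shows "m * n + 4 \<le> 4 * card D + m"
proof -
  note sub = dominating_set_grid_subset[OF D]
  have outside: "card (column D 0) = 0" "card (column D (Suc n)) = 0"
    using column_eq_empty[OF sub] by auto
  show ?thesis
    unfolding card_eq_sum_card_column[OF sub finite_atLeastAtMost finite_atLeastAtMost]
    using outside(1) card_columns_adjacent_to_empty[OF D] assms(2-4) outside(2)
    by (rule sum_gap_ge[of "\<lambda>i. card (column D i)"])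
qed

section \<open>Grids with three rows\<close>

definition covers_column :: "(nat \<times> nat) set \<Rightarrow> nat \<Rightarrow> bool" where
  "covers_column D i \<longleftrightarrow>
     ((1, i) \<in> D \<or> (2, i) \<in> D \<or> (1, i - 1) \<in> D \<or> (1, Suc i) \<in> D) \<and>
     ((2, i) \<in> D \<or> (1, i) \<in> D \<or> (3, i) \<in> D \<or> (2, i - 1) \<in> D \<or> (2, Suc i) \<in> D) \<and>
     ((3, i) \<in> D \<or> (2, i) \<in> D \<or> (3, i - 1) \<in> D \<or> (3, Suc i) \<in> D)"

lemma dominating_set_grid3_iff:
  "dominating_set (grid 3 n) D \<longleftrightarrow>
     D \<subseteq> {1, 2, 3} \<times> {1..n} \<and> (\<forall>i \<in> {1..n}. covers_column D i)"
proof -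
  have rows: "{1..3} = {1, 2, 3 :: nat}" by auto
  have "(\<forall>r \<in> {1..3}. (r, i) \<in> D \<or> (r - 1, i) \<in> D \<or> (Suc r, i) \<in> D \<or>
          (r, i - 1) \<in> D \<or> (r, Suc i) \<in> D) \<longleftrightarrow> covers_column D i"
    if "D \<subseteq> {1, 2, 3} \<times> {1..n}" for i
  proof -
    have "(0, i) \<notin> D" "(Suc 3, i) \<notin> D" using that by auto
    then show ?thesis
      unfolding rows by (simp add: covers_column_def numeral_2_eq_2 numeral_3_eq_3)
  qed
  then show ?thesis
    unfolding dominating_set_grid_iff rows by blast
qed

lemma tight_dominating_set_grid3_last_column:
  assumes D: "dominating_set (grid 3 n) D" and tight: "4 * card D = 3 * n + 1"
  shows "card (column D n) = 1" and "column D (n - 1) = {}"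
proof -
  note sub = dominating_set_grid_subset[OF D]
  have "0 < n" using tight by (cases n) auto
  have outside: "card (column D 0) = 0" "card (column D (Suc n)) = 0"
    using column_eq_empty[OF sub] by auto
  have tight_sum: "4 * (\<Sum>i = 1..n. card (column D i)) + 3 = 3 * n + 4"
    using card_eq_sum_card_column[OF sub] tight by simp
  note gap = card_columns_adjacent_to_empty[OF D]
  show last: "card (column D n) = 1"
    using tight_sum_gap_last[of "\<lambda>i. card (column D i)", OF outside(1) gap] outside(2)
      tight_sum \<open>0 < n\<close> by simp
  have "card (column D (n - 1)) = 0"
    using tight_sum_gap_penultimate[of "\<lambda>i. card (column D i)", OF outside(1) gap] last
      tight_sum by simp
  then show "column D (n - 1) = {}"
    using finite_column[OF sub] by simp
qed

lemma tight_dominating_set_grid3_mem: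
  assumes D: "dominating_set (grid 3 n) D" and tight: "4 * card D = 3 * n + 1"
  shows "(2, n) \<in> D"
proof (rule ccontr)
  assume not_mem: "(2, n) \<notin> D"
  note sub = dominating_set_grid_subset[OF D]
  have "n \<in> {1..n}" using tight by (cases n) auto
  then have "covers_column D n"
    using D by (simp add: dominating_set_grid3_iff)
  moreover have "(r, n - 1) \<notin> D" "(r, Suc n) \<notin> D" for r
    using tight_dominating_set_grid3_last_column(2)[OF D tight] sub by (auto simp: column_def)
  ultimately have "{1, 3} \<subseteq> column D n"
    using not_mem by (simp add: covers_column_def column_def)
  then have "card {1, 3 :: nat} \<le> card (column D n)"
    using finite_column[OF sub] by (intro card_mono) auto
  with tight_dominating_set_grid3_last_column(1)[OF D tight] show False by simp
qed

section \<open>Optimal patterns\<close>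

lemma column_mod_4_cases:
  fixes i k :: nat
  assumes "i \<in> {1..4 * k + 1}"
  obtains q where "i = 4 * q + 1" "q \<le> k" | q where "i = 4 * q + 2" "q < k"
    | q where "i = 4 * q + 3" "q < k" | q where "i = 4 * q + 4" "q < k"
proof -
  define q where "q = (i - 1) div 4"
  have "i = 4 * q + 1 \<and> q \<le> k \<or> i = 4 * q + 2 \<and> q < k \<or>
      i = 4 * q + 3 \<and> q < k \<or> i = 4 * q + 4 \<and> q < k"
    using assms div_mult_mod_eq[of "i - 1" 4] mod_less_divisor[of 4 "i - 1"]
    unfolding q_def atLeastAtMost_iff by arith
  then show thesis using that by blast
qed

definition zigzag :: "nat \<Rightarrow> (nat \<times> nat) set" where
  "zigzag k = (\<Union>j<k. {(2, 4 * j + 1), (1, 4 * j + 3), (3, 4 * j + 3)})"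

lemma mem_zigzag_iff:
  "(r, i) \<in> zigzag k \<longleftrightarrow> i < 4 * k \<and> (r = 2 \<and> i mod 4 = 1 \<or> (r = 1 \<or> r = 3) \<and> i mod 4 = 3)"
proof -
  have "i < 4 * k \<and> i mod 4 = s \<longleftrightarrow> (\<exists>j<k. i = 4 * j + s)" if "s < 4" for s
    using that div_mult_mod_eq[of i 4] by (auto intro!: exI[of _ "i div 4"])
  from this[of 1] this[of 3] show ?thesis
    unfolding zigzag_def by auto
qed

lemma card_zigzag_le: "card (zigzag k) \<le> 3 * k"
proof -
  have "card (zigzag k) \<le> (\<Sum>j<k. card {(2, 4 * j + 1), (1, 4 * j + 3), (3 :: nat, 4 * j + 3)})"
    unfolding zigzag_def by (rule card_UN_le) simp
  also have "\<dots> \<le> (\<Sum>j<k. 3)"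
    by (intro sum_mono) (simp add: card_insert_if)
  finally show ?thesis by simp
qed

lemma dominating_set_zigzag:
  "dominating_set (grid 3 (4 * k + 1)) (insert (2, 4 * k + 1) (zigzag k))"
  unfolding dominating_set_grid3_iff
proof (intro conjI ballI)
  show "insert (2, 4 * k + 1) (zigzag k) \<subseteq> {1, 2, 3} \<times> {1..4 * k + 1}"
    by (auto simp: mem_zigzag_iff intro: Suc_leI gr0I)
  show "covers_column (insert (2, 4 * k + 1) (zigzag k)) i" if "i \<in> {1..4 * k + 1}" for i
    using that
    by (cases rule: column_mod_4_cases; auto simp: covers_column_def mem_zigzag_iff; presburger)
qed

lemma domination_number_grid3:
  "domination_number (grid 3 (4 * k + 1)) = 3 * k + 1"
proof (rule domination_number_eqI)
  show "dominating_set (grid 3 (4 * k + 1)) (insert (2, 4 * k + 1) (zigzag k))"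
    by (rule dominating_set_zigzag)
  show "card (insert (2, 4 * k + 1) (zigzag k)) \<le> 3 * k + 1"
    using card_zigzag_le[of k] by (simp add: card_insert_le_m1)
  show "3 * k + 1 \<le> card D"
    if "dominating_set (grid 3 (4 * k + 1)) D" for D
    using card_dominating_set_grid_ge[OF that] by simp
qed

text \<open>
  The sets \<open>swap_pattern k\<close> (D) and \<open>swap_partner k\<close> (X) for \<open>k = 3\<close>. The matching \<open>swap_map k\<close> moves
  all cells of the zigzag but the first one to the left, and the two other cells vertically.

  \<^verbatim>\<open>
    . X D . . X D . . X D . D
    D X . X D . . X D . . X X
    . X D . . X D . . X D D .
  \<close>
\<close>

definition swap_pattern :: "nat \<Rightarrow> (nat \<times> nat) set" where
  "swap_pattern k = zigzag k \<union> {(3, 4 * k), (1, 4 * k + 1)}"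

definition swap_partner :: "nat \<Rightarrow> (nat \<times> nat) set" where
  "swap_partner k =
     {(r, i). 0 < i \<and> (r, Suc i) \<in> zigzag k} \<union> {(2, 2), (2, 4 * k), (2, 4 * k + 1)}"

definition swap_map :: "nat \<Rightarrow> nat \<times> nat \<Rightarrow> nat \<times> nat" where
  "swap_map k = (\<lambda>(r, i). if 4 * k \<le> i then (2, i) else if i = 1 then (2, 2) else (r, i - 1))"

definition swap_inverse :: "nat \<Rightarrow> nat \<times> nat \<Rightarrow> nat \<times> nat" where
  "swap_inverse k =
     (\<lambda>(r, i). if i = 4 * k then (3, i) else if i = 4 * k + 1 then (1, i)
       else if (r, i) = (2, 2) then (2, 1) else (r, Suc i))"

lemma card_swap_pattern_le: "card (swap_pattern k) \<le> 3 * k + 2"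
proof -
  have "card (swap_pattern k) \<le> card (zigzag k) + card {(3 :: nat, 4 * k), (1, 4 * k + 1)}"
    unfolding swap_pattern_def by (rule card_Un_le)
  then show ?thesis
    using card_zigzag_le[of k] by (simp add: card_insert_if)
qed

lemma dominating_set_swap_pattern:
  assumes "0 < k"
  shows "dominating_set (grid 3 (4 * k + 1)) (swap_pattern k)"
  unfolding dominating_set_grid3_iff
proof (intro conjI ballI)
  show "swap_pattern k \<subseteq> {1, 2, 3} \<times> {1..4 * k + 1}"
    using assms by (auto simp: swap_pattern_def mem_zigzag_iff intro: Suc_leI gr0I)
  show "covers_column (swap_pattern k) i" if "i \<in> {1..4 * k + 1}" for i
    using that assms
    by (cases rule: column_mod_4_cases;
        auto simp: covers_column_def swap_pattern_def mem_zigzag_iff; presburger)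
qed

lemma dominating_set_swap_partner:
  assumes "0 < k"
  shows "dominating_set (grid 3 (4 * k + 1)) (swap_partner k)"
  unfolding dominating_set_grid3_iff
proof (intro conjI ballI)
  show "swap_partner k \<subseteq> {1, 2, 3} \<times> {1..4 * k + 1}"
    using assms by (auto simp: swap_partner_def mem_zigzag_iff)
  show "covers_column (swap_partner k) i" if "i \<in> {1..4 * k + 1}" for i
    using that assms
    by (cases rule: column_mod_4_cases;
        auto simp: covers_column_def swap_partner_def mem_zigzag_iff; presburger)
qed

lemma bij_betw_swap_map:
  assumes "0 < k"
  shows "bij_betw (swap_map k) (swap_pattern k) (swap_partner k)"
proof -
  note defs = swap_map_def swap_inverse_def swap_pattern_def swap_partner_def mem_zigzag_iff
  have columns: "i \<in> {1..4 * k + 1}" if "(r, i) \<in> swap_pattern k \<union> swap_partner k" for r i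
    using that assms dominating_set_swap_pattern dominating_set_swap_partner
    by (blast dest: dominating_set_grid_subset)
  have forward: "swap_map k (r, i) \<in> swap_partner k \<and> swap_inverse k (swap_map k (r, i)) = (r, i)"
    if "(r, i) \<in> swap_pattern k" for r i
    using columns[OF UnI1[OF that]] that assms
    by (cases rule: column_mod_4_cases; auto simp: defs split: if_splits)
  have backward:
    "swap_inverse k (r, i) \<in> swap_pattern k \<and> swap_map k (swap_inverse k (r, i)) = (r, i)"
    if "(r, i) \<in> swap_partner k" for r i
    using columns[OF UnI2[OF that]] that assms
    by (cases rule: column_mod_4_cases; auto simp: defs split: if_splits)
  show ?thesis
    by (rule bij_betw_byWitness[where f' = "swap_inverse k"]) (use forward backward in auto)
qed

lemma swap_set_swap_pattern:
  assumes "0 < k"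
  shows "swap_set (grid 3 (4 * k + 1)) (swap_pattern k)"
proof (rule swap_setI)
  show "dominating_set (grid 3 (4 * k + 1)) (swap_pattern k)"
    using assms by (rule dominating_set_swap_pattern)
  show "dominating_set (grid 3 (4 * k + 1)) (swap_partner k)"
    using assms by (rule dominating_set_swap_partner)
  show "swap_pattern k \<inter> swap_partner k = {}"
    by (auto simp: swap_pattern_def swap_partner_def mem_zigzag_iff mod_Suc)
  show "bij_betw (swap_map k) (swap_pattern k) (swap_partner k)"
    using assms by (rule bij_betw_swap_map)
  show "(x, swap_map k x) \<in> parcs (grid 3 (4 * k + 1))"
    if "x \<in> swap_pattern k" for x
    using that assms
    by (cases x) (auto simp: swap_pattern_def mem_zigzag_iff swap_map_def parcs_grid_iff)
qed

theorem lemma30: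
  fixes n :: nat
  assumes "n > 9" and "n mod 4 = 1"
  shows "swap_number (path_graph 3 \<box> path_graph n) =
         enat (domination_number (path_graph 3 \<box> path_graph n) + 1)"
proof -
  obtain k where n: "n = 4 * k + 1"
    using assms(2) by (metis mult_div_mod_eq)
  then have "0 < k" using assms(1) by simp
  show ?thesis
    unfolding n
  proof (rule swap_number_eq_Suc_domination_number)
    show "(2, 4 * k + 1) \<in> D"
      if "dominating_set (grid 3 (4 * k + 1)) D"
        and "card D = domination_number (grid 3 (4 * k + 1))" for D
      using that domination_number_grid3[of k] by (intro tight_dominating_set_grid3_mem) simp_all
    show "swap_set (grid 3 (4 * k + 1)) (swap_pattern k)"
      using \<open>0 < k\<close> by (rule swap_set_swap_pattern)
    show "card (swap_pattern k) \<le> domination_number (grid 3 (4 * k + 1)) + 1"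
      using card_swap_pattern_le[of k] domination_number_grid3[of k] by simp
  qed
qed

end
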